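(* There is a constant $c>0$ such that the number of Graham classes of trees on $n$ vertices is $\Omega\!\left(e^{c(\log n)^{3/2}}\right)$ as $n\to\infty$.
   Context: All graphs are finite, simple and undirected; a tree is an acyclic connected graph. For a graph $G=(V,E)$ the line graph $L(G)$ has vertex set $E$, with distinct $e,f\in E$ adjacent iff $e\cap f\neq\emptyset$. Iterated line graphs: $L^{(0)}(G)=G$, $L^{(j+1)}(G)=L(L^{(j)}(G))$. Two trees $G,H$ are Graham equivalent if $|V(L^{(j)}(G))|=|V(L^{(j)}(H))|$ for all $j\ge 0$; the equivalence classes (of isomorphism classes of trees on $n$ vertices) are called Graham classes. *)

theory Defs
  imports Complex_Main "HOL-Library.Landau_Symbols" "HOL-Library.Nat_Bijection"
begin

type_synonym 'a ugraph = "'a set \<times> 'a set set"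

abbreviation verts :: "'a ugraph \<Rightarrow> 'a set" where
  "verts G \<equiv> fst G"

abbreviation edges :: "'a ugraph \<Rightarrow> 'a set set" where
  "edges G \<equiv> snd G"

definition fin_simple_graph :: "'a ugraph \<Rightarrow> bool" where
  "fin_simple_graph G \<longleftrightarrow>
     finite (verts G) \<and> (\<forall>e\<in>edges G. e \<subseteq> verts G \<and> card e = 2)"

definition adj_rel :: "'a ugraph \<Rightarrow> ('a \<times> 'a) set" where
  "adj_rel G = {(u, v). {u, v} \<in> edges G}"

definition connected_graph :: "'a ugraph \<Rightarrow> bool" where
  "connected_graph G \<longleftrightarrow>
     verts G \<noteq> {} \<and> (\<forall>u\<in>verts G. \<forall>v\<in>verts G. (u, v) \<in> (adj_rel G)\<^sup>*)"

text \<open>A cycle is given by the list of its vertices, without repeating the start vertex.\<close>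

definition is_cycle :: "'a ugraph \<Rightarrow> 'a list \<Rightarrow> bool" where
  "is_cycle G xs \<longleftrightarrow>
     3 \<le> length xs \<and> distinct xs \<and>
     (\<forall>i. Suc i < length xs \<longrightarrow> {xs ! i, xs ! Suc i} \<in> edges G) \<and>
     {last xs, hd xs} \<in> edges G"

definition acyclic_graph :: "'a ugraph \<Rightarrow> bool" where
  "acyclic_graph G \<longleftrightarrow> (\<nexists>xs. is_cycle G xs)"

definition is_tree :: "'a ugraph \<Rightarrow> bool" where
  "is_tree G \<longleftrightarrow> fin_simple_graph G \<and> connected_graph G \<and> acyclic_graph G"

definition graph_iso :: "'a ugraph \<Rightarrow> 'b ugraph \<Rightarrow> bool" where
  "graph_iso G H \<longleftrightarrow>
     (\<exists>f. bij_betw f (verts G) (verts H) \<and>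
          (\<forall>u\<in>verts G. \<forall>v\<in>verts G. {u, v} \<in> edges G \<longleftrightarrow> {f u, f v} \<in> edges H))"

definition line_graph :: "'a ugraph \<Rightarrow> 'a set ugraph" where
  "line_graph G =
     (edges G, {{e, f} | e f. e \<in> edges G \<and> f \<in> edges G \<and> e \<noteq> f \<and> e \<inter> f \<noteq> {}})"

definition relabel :: "('a \<Rightarrow> 'b) \<Rightarrow> 'a ugraph \<Rightarrow> 'b ugraph" where
  "relabel h G = (h ` verts G, (\<lambda>e. h ` e) ` edges G)"

text \<open>
  Each application of \<^const>\<open>line_graph\<close> changes the type of the vertices from \<open>'a\<close> to \<open>'a set\<close>.
  To iterate it on graphs over the naturals, the new vertices (which are finite sets of naturals)
  are renamed by \<^const>\<open>set_encode\<close>, which is injective on finite sets; the lemma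
  \<open>graph_iso_relabel_line_graph\<close> below shows that this does not change the isomorphism type.
\<close>

fun iter_line_graph :: "nat \<Rightarrow> nat ugraph \<Rightarrow> nat ugraph" where
  "iter_line_graph 0 G = G"
| "iter_line_graph (Suc j) G = relabel set_encode (line_graph (iter_line_graph j G))"

lemma graph_iso_relabel:
  assumes inj: "inj_on h (verts G)" and sub: "\<And>e. e \<in> edges G \<Longrightarrow> e \<subseteq> verts G"
  shows "graph_iso G (relabel h G)"
  unfolding graph_iso_def
proof (intro exI conjI ballI)
  show "bij_betw h (verts G) (verts (relabel h G))"
    using inj by (simp add: relabel_def bij_betw_def)
next
  fix u v assume uv: "u \<in> verts G" "v \<in> verts G"
  show "{u, v} \<in> edges G \<longleftrightarrow> {h u, h v} \<in> edges (relabel h G)"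
  proof
    assume "{u, v} \<in> edges G"
    then have "h ` {u, v} \<in> edges (relabel h G)"
      unfolding relabel_def snd_conv by (rule imageI)
    then show "{h u, h v} \<in> edges (relabel h G)" by simp
  next
    assume "{h u, h v} \<in> edges (relabel h G)"
    then obtain e where e: "e \<in> edges G" "h ` {u, v} = h ` e"
      by (auto simp: relabel_def)
    have "{u, v} = e"
      using inj_on_image_eq_iff[OF inj, of "{u, v}" e] e sub uv by auto
    then show "{u, v} \<in> edges G" using e by simp
  qed
qed

lemma fin_simple_graph_relabel_line_graph:
  assumes "fin_simple_graph G"
  shows "fin_simple_graph (relabel set_encode (line_graph G))"
proof -
  have fin: "finite (edges G)"
    using assms unfolding fin_simple_graph_def
    by (intro finite_subset[of "edges G" "Pow (verts G)"]) auto
  have finE: "finite e" if "e \<in> edges G" for e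
    using assms that unfolding fin_simple_graph_def by (meson finite_subset)
  have "set_encode e \<noteq> set_encode f" if "e \<in> edges G" "f \<in> edges G" "e \<noteq> f" for e f
    using that finE set_encode_eq by blast
  then show ?thesis
    using fin by (auto simp: fin_simple_graph_def relabel_def line_graph_def card_2_iff)
qed

lemma graph_iso_relabel_line_graph:
  assumes "fin_simple_graph G"
  shows "graph_iso (line_graph G) (relabel set_encode (line_graph G))"
proof (rule graph_iso_relabel)
  have "edges G \<subseteq> Collect finite"
    using assms unfolding fin_simple_graph_def by (auto intro: finite_subset)
  then show "inj_on set_encode (verts (line_graph G))"
    by (auto simp: line_graph_def intro: inj_on_subset[OF inj_on_set_encode])
qed (auto simp: line_graph_def)

definition graham_equiv :: "nat ugraph \<Rightarrow> nat ugraph \<Rightarrow> bool" where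
  "graham_equiv G H \<longleftrightarrow>
     (\<forall>j. card (verts (iter_line_graph j G)) = card (verts (iter_line_graph j H)))"

definition trees_on :: "nat \<Rightarrow> nat ugraph set" where
  "trees_on n = {G. is_tree G \<and> verts G = {..<n}}"

definition tree_iso_classes :: "nat \<Rightarrow> nat ugraph set set" where
  "tree_iso_classes n =
     trees_on n // {(G, H). G \<in> trees_on n \<and> H \<in> trees_on n \<and> graph_iso G H}"

definition graham_classes :: "nat \<Rightarrow> nat ugraph set set set" where
  "graham_classes n =
     tree_iso_classes n //
       {(X, Y). X \<in> tree_iso_classes n \<and> Y \<in> tree_iso_classes n \<and>
                (\<exists>G\<in>X. \<exists>H\<in>Y. graham_equiv G H)}"

end

theory Submission
  imports Defs "HOL-Library.FuncSet"
begin

text \<open>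
  A vertex of the \<open>i\<close>-th line graph of \<open>G\<close> lives on a set of at most \<open>i + 1\<close> vertices of \<open>G\<close>,
  its support, and the number of vertices with support \<open>S\<close> depends only on the induced graph on
  \<open>S\<close>. Take a long path with hubs at distance more than \<open>2 ^ k\<close> from each other, and attach
  \<open>d h\<close> leaves to the hub \<open>h\<close>. For \<open>i \<le> k\<close> no support meets the leaves of two hubs, so up to
  a contribution of the path the number of vertices of the \<open>i\<close>-th line graph is
  \<open>\<Sum>h. \<Sum>s=1..i. (d h choose s) * w i s\<close>, where \<open>w i i > 0\<close> because a star with \<open>i\<close> leaves
  is the support of some vertex. This triangular system determines \<open>\<Sum>h. d h choose i\<close> for all
  \<open>1 \<le> i \<le> k\<close>, and hence, if all \<open>d h \<le> k\<close>, the number of hubs with \<open>m\<close> leaves for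
  every \<open>m \<ge> 1\<close>. About \<open>k\<close> of these numbers can be chosen freely below a power of \<open>n\<close> when
  \<open>k\<close> is of order \<open>sqrt (log n)\<close>.
\<close>

section \<open>Supports of vertices of iterated line graphs\<close>

lemma fin_simple_graph_iter:
  "fin_simple_graph G \<Longrightarrow> fin_simple_graph (iter_line_graph i G)"
  by (induction i) (auto intro: fin_simple_graph_relabel_line_graph)

lemma finite_edge:
  assumes "fin_simple_graph G" "e \<in> edges G"
  shows "finite e"
  using assms unfolding fin_simple_graph_def by (meson finite_subset)

lemma verts_iter_Suc:
  "verts (iter_line_graph (Suc i) G) = set_encode ` edges (iter_line_graph i G)"
  by (simp add: relabel_def line_graph_def)

lemma edges_iter_Suc:
  "edges (iter_line_graph (Suc i) G) =
     {{set_encode e, set_encode f} | e f. e \<in> edges (iter_line_graph i G) \<and>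
        f \<in> edges (iter_line_graph i G) \<and> e \<noteq> f \<and> e \<inter> f \<noteq> {}}"
proof -
  have *: "(\<lambda>e. h ` e) ` {{e, f} | e f. P e f} = {{h e, h f} | e f. P e f}"
    for h :: "nat set \<Rightarrow> nat" and P
  proof (intro equalityI subsetI)
    fix y assume "y \<in> (\<lambda>e. h ` e) ` {{e, f} | e f. P e f}"
    then show "y \<in> {{h e, h f} | e f. P e f}" by fastforce
  next
    fix y assume "y \<in> {{h e, h f} | e f. P e f}"
    then obtain e f where ef: "y = h ` {e, f}" "P e f" by auto
    then show "y \<in> (\<lambda>e. h ` e) ` {{e, f} | e f. P e f}" by blast
  qed
  show ?thesis
    unfolding iter_line_graph.simps relabel_def line_graph_def snd_conv by (rule *)
qed

text \<open>Vertices of a relabelled line graph are codes of edges, so \<open>set_decode\<close>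
  recovers the two ends one level down. Iterating this leads back to the vertices of the original
  graph from which \<open>x\<close> is built.\<close>

fun vsupp :: "nat \<Rightarrow> nat \<Rightarrow> nat set" where
  "vsupp 0 x = {x}"
| "vsupp (Suc i) x = (\<Union>y\<in>set_decode x. vsupp i y)"

lemma vsupp_encode: "finite e \<Longrightarrow> vsupp (Suc i) (set_encode e) = (\<Union>y\<in>e. vsupp i y)"
  by simp

lemma edgeE:
  assumes "fin_simple_graph G" "e \<in> edges G"
  obtains u v where "e = {u, v}" "u \<noteq> v" "u \<in> verts G" "v \<in> verts G"
proof -
  have "card e = 2" "e \<subseteq> verts G" using assms unfolding fin_simple_graph_def by auto
  then show thesis using that unfolding card_2_iff by blast
qed

lemma iter_vertexE:
  assumes G: "fin_simple_graph G" and x: "x \<in> verts (iter_line_graph (Suc i) G)"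
  obtains a b where "x = set_encode {a, b}" "{a, b} \<in> edges (iter_line_graph i G)" "a \<noteq> b"
    "a \<in> verts (iter_line_graph i G)" "b \<in> verts (iter_line_graph i G)"
    "vsupp (Suc i) x = vsupp i a \<union> vsupp i b"
proof -
  obtain e where e: "e \<in> edges (iter_line_graph i G)" "x = set_encode e"
    using x unfolding verts_iter_Suc by blast
  obtain a b where ab: "e = {a, b}" "a \<noteq> b"
      "a \<in> verts (iter_line_graph i G)" "b \<in> verts (iter_line_graph i G)"
    using edgeE[OF fin_simple_graph_iter[OF G] e(1)] .
  have "vsupp (Suc i) x = vsupp i a \<union> vsupp i b"
    using ab(1) e(2) vsupp_encode[of e i] by simp
  then show thesis using that ab e by simp
qed

text \<open>Adjacent vertices from level 1 on are edges with a common end \<open>b\<close>. The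
  inductions below use \<open>b\<close> as the part that the two supports share.\<close>

lemma iter_edgeE:
  assumes G: "fin_simple_graph G" and e: "{x, y} \<in> edges (iter_line_graph (Suc i) G)"
  obtains a b c where "x = set_encode {a, b}" "y = set_encode {b, c}"
    "{a, b} \<in> edges (iter_line_graph i G)" "{b, c} \<in> edges (iter_line_graph i G)"
    "vsupp (Suc i) x = vsupp i a \<union> vsupp i b" "vsupp (Suc i) y = vsupp i b \<union> vsupp i c"
    "b \<in> verts (iter_line_graph i G)"
proof -
  let ?H = "iter_line_graph i G"
  have H: "fin_simple_graph ?H" using fin_simple_graph_iter[OF G] .
  obtain e f where ef: "{x, y} = {set_encode e, set_encode f}" "e \<in> edges ?H" "f \<in> edges ?H"
      "e \<inter> f \<noteq> {}"
    using e unfolding edges_iter_Suc by blast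
  obtain e' f' where ef': "x = set_encode e'" "y = set_encode f'" "e' \<in> edges ?H" "f' \<in> edges ?H"
      "e' \<inter> f' \<noteq> {}"
    using ef unfolding doubleton_eq_iff by blast
  then obtain b where b: "b \<in> e'" "b \<in> f'" by blast
  obtain a where a: "e' = {a, b}"
    by (rule edgeE[OF H ef'(3)]) (use b in blast)
  obtain c where c: "f' = {b, c}"
    by (rule edgeE[OF H ef'(4)]) (use b in blast)
  have "vsupp (Suc i) x = vsupp i a \<union> vsupp i b" "vsupp (Suc i) y = vsupp i b \<union> vsupp i c"
    using ef' a c vsupp_encode[of e' i] vsupp_encode[of f' i] by auto
  moreover have "b \<in> verts ?H" using b ef' H unfolding fin_simple_graph_def by blast
  ultimately show thesis using that ef' a c by blast
qed

lemma vsupp_props: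
  assumes G: "fin_simple_graph G"
  shows "x \<in> verts (iter_line_graph i G) \<Longrightarrow>
    vsupp i x \<subseteq> verts G \<and> finite (vsupp i x) \<and> vsupp i x \<noteq> {}"
proof (induction i arbitrary: x)
  case (Suc i)
  show ?case
    by (rule iter_vertexE[OF G Suc.prems]) (use Suc.IH in auto)
qed auto

text \<open>If \<open>x\<close> and \<open>y\<close> are the edges \<open>{a, b}\<close> and
  \<open>{b, c}\<close> one level down, whatever \<open>x\<close> has beyond \<open>y\<close> lies
  in the support of \<open>a\<close> but outside that of \<open>b\<close>, and \<open>a\<close>,
  \<open>b\<close> are adjacent. So the bound is inherited from level 0, where supports are
  singletons.\<close>

lemma card_vsupp_diff_le_1:
  assumes G: "fin_simple_graph G"
  shows "{x, y} \<in> edges (iter_line_graph i G) \<Longrightarrow> card (vsupp i x - vsupp i y) \<le> 1"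
proof (induction i arbitrary: x y)
  case (Suc i)
  obtain a b c where abc: "{a, b} \<in> edges (iter_line_graph i G)"
      "vsupp (Suc i) x = vsupp i a \<union> vsupp i b" "vsupp (Suc i) y = vsupp i b \<union> vsupp i c"
    by (rule iter_edgeE[OF G Suc.prems])
  have "a \<in> verts (iter_line_graph i G)"
    using abc(1) fin_simple_graph_iter[OF G] unfolding fin_simple_graph_def by blast
  then have "finite (vsupp i a)" using vsupp_props[OF G] by blast
  then have "card (vsupp (Suc i) x - vsupp (Suc i) y) \<le> card (vsupp i a - vsupp i b)"
    using abc by (intro card_mono) auto
  then show ?case using Suc.IH[OF abc(1)] by simp
next
  case 0
  have "card ({x} - {y}) \<le> card {x}" by (intro card_mono) auto
  then show ?case by simp
qed

lemma card_vsupp_le: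
  assumes G: "fin_simple_graph G"
  shows "x \<in> verts (iter_line_graph i G) \<Longrightarrow> card (vsupp i x) \<le> Suc i"
proof (induction i arbitrary: x)
  case (Suc i)
  obtain a b where ab: "{a, b} \<in> edges (iter_line_graph i G)" "b \<in> verts (iter_line_graph i G)"
      "vsupp (Suc i) x = vsupp i a \<union> vsupp i b"
    by (rule iter_vertexE[OF G Suc.prems])
  have "vsupp (Suc i) x = (vsupp i a - vsupp i b) \<union> vsupp i b" using ab by auto
  then have "card (vsupp (Suc i) x) \<le> card (vsupp i a - vsupp i b) + card (vsupp i b)"
    by (metis card_Un_le)
  then show ?case using card_vsupp_diff_le_1[OF G ab(1)] Suc.IH[OF ab(2)] by linarith
qed auto

text \<open>At level 1 supports are edges of \<open>G\<close>, and later supports are unions of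
  earlier ones. This forces a support that contains a leaf to contain its hub as well; level 0 is
  excluded because singletons have no edge.\<close>

lemma vsupp_no_isolated:
  assumes G: "fin_simple_graph G"
  shows "x \<in> verts (iter_line_graph (Suc i) G) \<Longrightarrow> u \<in> vsupp (Suc i) x \<Longrightarrow>
    \<exists>v\<in>vsupp (Suc i) x. {u, v} \<in> edges G"
proof (induction i arbitrary: x)
  case 0
  obtain a b where ab: "{a, b} \<in> edges G" "vsupp (Suc 0) x = {a, b}"
    by (rule iter_vertexE[OF G 0(1)], unfold iter_line_graph.simps(1) vsupp.simps(1) insert_is_Un[symmetric]) blast
  then show ?case using 0(2) by (auto simp: insert_commute)
next
  case (Suc i)
  obtain a b where ab: "a \<in> verts (iter_line_graph (Suc i) G)" "b \<in> verts (iter_line_graph (Suc i) G)"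
      "vsupp (Suc (Suc i)) x = vsupp (Suc i) a \<union> vsupp (Suc i) b"
    by (rule iter_vertexE[OF G Suc.prems(1)])
  show ?case unfolding ab(3)
    using Suc.IH[OF ab(1)] Suc.IH[OF ab(2)] Suc.prems(2) ab(3) by blast
qed

text \<open>From level 1 on the supports of adjacent vertices intersect, so passing through a common
  point \<open>w\<close> at most doubles the spread of the 1-Lipschitz function \<open>p\<close>. At
  level 0 adjacent vertices have no common support, and the Lipschitz condition is applied
  directly.\<close>

lemma vsupp_spread:
  fixes p :: "nat \<Rightarrow> nat"
  assumes G: "fin_simple_graph G"
    and p: "\<And>u v. {u, v} \<in> edges G \<Longrightarrow> p u \<le> Suc (p v)"
  shows "x \<in> verts (iter_line_graph i G) \<Longrightarrow> u \<in> vsupp i x \<Longrightarrow> v \<in> vsupp i x \<Longrightarrow>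
    p u \<le> p v + 2 ^ i"
proof (induction i arbitrary: x u v)
  case (Suc i)
  obtain a b where ab: "{a, b} \<in> edges (iter_line_graph i G)"
      "a \<in> verts (iter_line_graph i G)" "b \<in> verts (iter_line_graph i G)"
      "vsupp (Suc i) x = vsupp i a \<union> vsupp i b"
    by (rule iter_vertexE[OF G Suc.prems(1)])
  show ?case
  proof (cases i)
    case 0
    then have "p a \<le> Suc (p b)" "p b \<le> Suc (p a)" using p ab(1) by (auto simp: insert_commute)
    then show ?thesis using 0 ab Suc.prems by auto
  next
    case (Suc j)
    obtain c where c: "c \<in> verts (iter_line_graph j G)"
      "vsupp j c \<subseteq> vsupp i a" "vsupp j c \<subseteq> vsupp i b"
      unfolding Suc by (rule iter_edgeE[OF G ab(1)[unfolded Suc]]) blast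
    then obtain w where w: "w \<in> vsupp i a" "w \<in> vsupp i b" using vsupp_props[OF G c(1)] by blast
    have "p u \<le> p w + 2 ^ i" "p w \<le> p v + 2 ^ i"
      using Suc.IH ab w Suc.prems by auto
    then show ?thesis by simp
  qed
qed auto

section \<open>Counting vertices by their support\<close>

definition induced :: "'a ugraph \<Rightarrow> 'a set \<Rightarrow> 'a ugraph" where
  "induced G S = (S, {e \<in> edges G. e \<subseteq> S})"

lemma fin_simple_graph_induced:
  assumes "fin_simple_graph G" "S \<subseteq> verts G"
  shows "fin_simple_graph (induced G S)"
  using assms by (auto simp: fin_simple_graph_def induced_def intro: finite_subset)

text \<open>The support of an edge code lies in \<open>S\<close> iff the supports of both ends do,
  so restricting to \<open>S\<close> commutes with each line graph step. The codes themselves are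
  unchanged, which gives an equality and not just an isomorphism.\<close>

lemma iter_line_graph_induced:
  assumes G: "fin_simple_graph G" and S: "S \<subseteq> verts G"
  shows "iter_line_graph i (induced G S) =
    induced (iter_line_graph i G) {x \<in> verts (iter_line_graph i G). vsupp i x \<subseteq> S}"
proof (induction i)
  case 0
  then show ?case using S by (simp add: induced_def) blast
next
  case (Suc i)
  let ?H = "iter_line_graph i G"
  let ?E = "{e \<in> edges ?H. \<forall>x\<in>e. vsupp i x \<subseteq> S}"
  have H: "fin_simple_graph ?H" using fin_simple_graph_iter[OF G] .
  have E: "edges (iter_line_graph i (induced G S)) = ?E"
    using Suc.IH H by (auto simp: induced_def fin_simple_graph_def)
  have sub: "vsupp (Suc i) (set_encode e) \<subseteq> S \<longleftrightarrow> (\<forall>x\<in>e. vsupp i x \<subseteq> S)" if "e \<in> edges ?H" for e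
    using vsupp_encode[OF finite_edge[OF H that]] by blast
  let ?T = "{x \<in> verts (iter_line_graph (Suc i) G). vsupp (Suc i) x \<subseteq> S}"
  have V: "verts (iter_line_graph (Suc i) (induced G S)) = ?T"
    unfolding verts_iter_Suc E using sub by blast
  have enc: "set_encode e \<in> ?T \<longleftrightarrow> e \<in> ?E" if "e \<in> edges ?H" for e
    using that sub unfolding verts_iter_Suc by blast
  have "edges (iter_line_graph (Suc i) (induced G S)) = {e \<in> edges (iter_line_graph (Suc i) G). e \<subseteq> ?T}"
  proof (intro equalityI subsetI)
    fix z assume "z \<in> edges (iter_line_graph (Suc i) (induced G S))"
    then obtain e f where ef: "z = {set_encode e, set_encode f}" "e \<in> ?E" "f \<in> ?E" "e \<noteq> f" "e \<inter> f \<noteq> {}"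
      unfolding edges_iter_Suc E by blast
    then have "set_encode e \<in> ?T" "set_encode f \<in> ?T" using enc by auto
    moreover have "z \<in> edges (iter_line_graph (Suc i) G)" unfolding edges_iter_Suc using ef by blast
    ultimately show "z \<in> {e \<in> edges (iter_line_graph (Suc i) G). e \<subseteq> ?T}" using ef(1) by blast
  next
    fix z assume z: "z \<in> {e \<in> edges (iter_line_graph (Suc i) G). e \<subseteq> ?T}"
    then obtain e f where ef: "z = {set_encode e, set_encode f}" "e \<in> edges ?H" "f \<in> edges ?H"
        "e \<noteq> f" "e \<inter> f \<noteq> {}"
      unfolding edges_iter_Suc by blast
    then have "e \<in> ?E" "f \<in> ?E" using enc z by blast+
    then show "z \<in> edges (iter_line_graph (Suc i) (induced G S))"
      unfolding edges_iter_Suc E using ef by blast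
  qed
  then show ?case using V by (simp only: induced_def prod_eq_iff fst_conv snd_conv)
qed

definition supp_count :: "nat \<Rightarrow> nat ugraph \<Rightarrow> nat set \<Rightarrow> nat" where
  "supp_count i G S = card {x \<in> verts (iter_line_graph i G). vsupp i x = S}"

lemma finite_verts_iter: "fin_simple_graph G \<Longrightarrow> finite (verts (iter_line_graph i G))"
  using fin_simple_graph_iter unfolding fin_simple_graph_def by blast

text \<open>Sorting the vertices by their exact support expresses the sizes as a sum over subsets;
  inverting this sum shows that \<open>supp_count\<close> depends only on the induced graph.\<close>

lemma card_verts_iter_induced:
  assumes G: "fin_simple_graph G" and S: "S \<subseteq> verts G"
  shows "card (verts (iter_line_graph i (induced G S))) = (\<Sum>T\<in>Pow S. supp_count i G T)"
proof -
  have finS: "finite S" using G S unfolding fin_simple_graph_def by (blast intro: finite_subset)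
  have "verts (iter_line_graph i (induced G S)) =
      (\<Union>T\<in>Pow S. {x \<in> verts (iter_line_graph i G). vsupp i x = T})"
    unfolding iter_line_graph_induced[OF G S] by (auto simp: induced_def)
  also have "card \<dots> = (\<Sum>T\<in>Pow S. supp_count i G T)"
    unfolding supp_count_def
    by (rule card_UN_disjoint) (use finS finite_verts_iter[OF G] in auto)
  finally show ?thesis .
qed

lemma induced_verts:
  "fin_simple_graph G \<Longrightarrow> induced G (verts G) = G"
  by (auto simp: induced_def fin_simple_graph_def prod_eq_iff)

lemma supp_count_eq_0I:
  assumes "\<And>x. x \<in> verts (iter_line_graph i G) \<Longrightarrow> vsupp i x \<noteq> S"
  shows "supp_count i G S = 0"
  using assms unfolding supp_count_def by (metis (mono_tags, lifting) card.empty empty_Collect_eq)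

section \<open>Isomorphism invariance of iterated line graphs and of support counts\<close>

lemma graph_iso_line_graph:
  assumes G: "fin_simple_graph G" and H: "fin_simple_graph H" and iso: "graph_iso G H"
  shows "graph_iso (line_graph G) (line_graph H)"
proof -
  obtain f where f: "bij_betw f (verts G) (verts H)"
    and adj: "\<And>u v. u \<in> verts G \<Longrightarrow> v \<in> verts G \<Longrightarrow> {u, v} \<in> edges G \<longleftrightarrow> {f u, f v} \<in> edges H"
    using iso unfolding graph_iso_def by blast
  have inj: "inj_on f (verts G)" using f by (simp add: bij_betw_def)
  have sub: "e \<subseteq> verts G" if "e \<in> edges G" for e
    using G that by (auto simp: fin_simple_graph_def)
  have img: "f ` e \<in> edges H" if e: "e \<in> edges G" for e
    by (rule edgeE[OF G e]) (use adj e in auto)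
  have surj: "\<exists>e\<in>edges G. f ` e = e'" if e': "e' \<in> edges H" for e'
  proof (rule edgeE[OF H e'])
    fix u v assume uv: "e' = {u, v}" "u \<in> verts H" "v \<in> verts H"
    then obtain a b where ab: "a \<in> verts G" "b \<in> verts G" "u = f a" "v = f b"
      using f unfolding bij_betw_def by blast
    then have "{a, b} \<in> edges G" using adj uv e' by auto
    then show ?thesis using ab uv(1) by (intro bexI[of _ "{a, b}"]) auto
  qed
  have eq: "f ` e1 = f ` e2 \<longleftrightarrow> e1 = e2" if "e1 \<in> edges G" "e2 \<in> edges G" for e1 e2
    using inj_on_image_eq_iff[OF inj] sub that by blast
  have int: "f ` e1 \<inter> f ` e2 = {} \<longleftrightarrow> e1 \<inter> e2 = {}" if "e1 \<in> edges G" "e2 \<in> edges G" for e1 e2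
    using inj_on_image_Int[OF inj sub[OF that(1)] sub[OF that(2)]] by blast
  have L: "{e1, e2} \<in> edges (line_graph K) \<longleftrightarrow>
      e1 \<in> edges K \<and> e2 \<in> edges K \<and> e1 \<noteq> e2 \<and> e1 \<inter> e2 \<noteq> {}" for K :: "'c ugraph" and e1 e2
    unfolding line_graph_def snd_conv mem_Collect_eq
  proof
    assume "\<exists>e f. {e1, e2} = {e, f} \<and> e \<in> edges K \<and> f \<in> edges K \<and> e \<noteq> f \<and> e \<inter> f \<noteq> {}"
    then obtain e f where "{e1, e2} = {e, f}" "e \<in> edges K" "f \<in> edges K" "e \<noteq> f" "e \<inter> f \<noteq> {}"
      by blast
    then show "e1 \<in> edges K \<and> e2 \<in> edges K \<and> e1 \<noteq> e2 \<and> e1 \<inter> e2 \<noteq> {}"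
      unfolding doubleton_eq_iff by (metis inf_commute)
  qed blast
  show ?thesis
    unfolding graph_iso_def
  proof (intro exI conjI ballI)
    show "bij_betw ((`) f) (verts (line_graph G)) (verts (line_graph H))"
      unfolding line_graph_def fst_conv
    proof (rule bij_betw_imageI)
      show "inj_on ((`) f) (edges G)" using eq by (auto simp: inj_on_def)
      show "(`) f ` edges G = edges H" using img surj by fast
    qed
    fix e1 e2 assume "e1 \<in> verts (line_graph G)" "e2 \<in> verts (line_graph G)"
    then have e: "e1 \<in> edges G" "e2 \<in> edges G" by (simp_all add: line_graph_def)
    show "{e1, e2} \<in> edges (line_graph G) \<longleftrightarrow> {f ` e1, f ` e2} \<in> edges (line_graph H)"
      unfolding L using e img eq[OF e] int[OF e] by blast
  qed
qed

lemma graph_iso_trans: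
  assumes "graph_iso G H" "graph_iso H K"
  shows "graph_iso G K"
proof -
  obtain f g where f: "bij_betw f (verts G) (verts H)"
      "\<forall>u\<in>verts G. \<forall>v\<in>verts G. {u, v} \<in> edges G \<longleftrightarrow> {f u, f v} \<in> edges H"
    and g: "bij_betw g (verts H) (verts K)"
      "\<forall>u\<in>verts H. \<forall>v\<in>verts H. {u, v} \<in> edges H \<longleftrightarrow> {g u, g v} \<in> edges K"
    using assms unfolding graph_iso_def by blast
  show ?thesis unfolding graph_iso_def
  proof (intro exI conjI ballI)
    show "bij_betw (g \<circ> f) (verts G) (verts K)" using f g by (blast intro: bij_betw_trans)
    fix u v assume "u \<in> verts G" "v \<in> verts G"
    then show "{u, v} \<in> edges G \<longleftrightarrow> {(g \<circ> f) u, (g \<circ> f) v} \<in> edges K"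
      using f g by (simp add: bij_betw_apply)
  qed
qed

lemma graph_iso_sym:
  assumes "graph_iso G H"
  shows "graph_iso H G"
proof -
  obtain f where f: "bij_betw f (verts G) (verts H)"
      "\<forall>u\<in>verts G. \<forall>v\<in>verts G. {u, v} \<in> edges G \<longleftrightarrow> {f u, f v} \<in> edges H"
    using assms unfolding graph_iso_def by blast
  let ?g = "inv_into (verts G) f"
  show ?thesis unfolding graph_iso_def
  proof (intro exI conjI ballI)
    show g: "bij_betw ?g (verts H) (verts G)" using f(1) by (rule bij_betw_inv_into)
    fix u v assume uv: "u \<in> verts H" "v \<in> verts H"
    then have "?g u \<in> verts G" "?g v \<in> verts G" "f (?g u) = u" "f (?g v) = v"
      using f(1) g by (auto simp: bij_betw_apply bij_betw_inv_into_right)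
    then show "{u, v} \<in> edges H \<longleftrightarrow> {?g u, ?g v} \<in> edges G" using f(2) by metis
  qed
qed

lemma graph_iso_iter:
  assumes "fin_simple_graph G" "fin_simple_graph H" "graph_iso G H"
  shows "graph_iso (iter_line_graph i G) (iter_line_graph i H)"
proof (induction i)
  case (Suc i)
  have fin: "fin_simple_graph (iter_line_graph i G)" "fin_simple_graph (iter_line_graph i H)"
    using assms by (auto intro: fin_simple_graph_iter)
  show ?case unfolding iter_line_graph.simps
    using graph_iso_line_graph[OF fin Suc.IH] fin
    by (meson graph_iso_relabel_line_graph graph_iso_sym graph_iso_trans)
qed (use assms in simp)

lemma card_verts_iter_iso:
  assumes "fin_simple_graph G" "fin_simple_graph H" "graph_iso G H"
  shows "card (verts (iter_line_graph i G)) = card (verts (iter_line_graph i H))"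
  using graph_iso_iter[OF assms, of i] unfolding graph_iso_def by (blast intro: bij_betw_same_card)

text \<open>Both sides satisfy the same recursion, by Moebius inversion over the subsets of the support.\<close>

lemma supp_count_iso:
  assumes G: "fin_simple_graph G" and H: "fin_simple_graph H"
  shows "S \<subseteq> verts G \<Longrightarrow> f ` S \<subseteq> verts H \<Longrightarrow> inj_on f S \<Longrightarrow>
    (\<And>u v. u \<in> S \<Longrightarrow> v \<in> S \<Longrightarrow> {u, v} \<in> edges G \<longleftrightarrow> {f u, f v} \<in> edges H) \<Longrightarrow>
    supp_count i G S = supp_count i H (f ` S)"
proof (induction "card S" arbitrary: S rule: less_induct)
  case less
  have fin: "finite S" using G less.prems(1) unfolding fin_simple_graph_def by (blast intro: finite_subset)
  have "graph_iso (induced G S) (induced H (f ` S))"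
    unfolding graph_iso_def
  proof (intro exI conjI ballI)
    show "bij_betw f (verts (induced G S)) (verts (induced H (f ` S)))"
      using less.prems(3) by (simp add: induced_def bij_betw_def)
    fix u v assume "u \<in> verts (induced G S)" "v \<in> verts (induced G S)"
    then have "u \<in> S" "v \<in> S" by (simp_all add: induced_def)
    then show "{u, v} \<in> edges (induced G S) \<longleftrightarrow> {f u, f v} \<in> edges (induced H (f ` S))"
      using less.prems(4)[of u v] by (simp add: induced_def)
  qed
  then have "(\<Sum>T\<in>Pow S. supp_count i G T) = (\<Sum>T\<in>Pow (f ` S). supp_count i H T)"
    using card_verts_iter_iso[OF fin_simple_graph_induced[OF G less.prems(1)]
        fin_simple_graph_induced[OF H less.prems(2)], of i]
    unfolding card_verts_iter_induced[OF G less.prems(1)] card_verts_iter_induced[OF H less.prems(2)] by blast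
  moreover have "(\<Sum>T\<in>Pow (f ` S). supp_count i H T) = (\<Sum>T\<in>Pow S. supp_count i H (f ` T))"
    by (rule sum.reindex_bij_betw[OF bij_betw_Pow[OF inj_on_imp_bij_betw[OF less.prems(3)]], symmetric])
  ultimately have "(\<Sum>T\<in>Pow S. supp_count i G T) = (\<Sum>T\<in>Pow S. supp_count i H (f ` T))"
    by simp
  moreover have "(\<Sum>T\<in>Pow S - {S}. supp_count i G T) = (\<Sum>T\<in>Pow S - {S}. supp_count i H (f ` T))"
  proof (rule sum.cong[OF refl])
    fix T assume T: "T \<in> Pow S - {S}"
    then have "card T < card S" using fin by (simp add: psubset_card_mono psubset_eq)
    then show "supp_count i G T = supp_count i H (f ` T)"
    proof (rule less.hyps)
      show "T \<subseteq> verts G" "f ` T \<subseteq> verts H" using T less.prems by blast+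
      show "inj_on f T" using T less.prems(3) inj_on_subset by blast
      show "{u, v} \<in> edges G \<longleftrightarrow> {f u, f v} \<in> edges H" if "u \<in> T" "v \<in> T" for u v
        using that T less.prems(4) by blast
    qed
  qed
  ultimately show ?case using fin by (simp add: sum.remove[of "Pow S" S])
qed

text \<open>The clause on neighbours makes the induction work: the edge from \<open>x\<close> to the
  neighbour that adds a leaf \<open>l\<close> is the next vertex, and the edges from
  \<open>x\<close> to the neighbours for the remaining leaves share the end \<open>x\<close> with
  it, hence are its neighbours one level up.\<close>

lemma star_vertex_exists:
  assumes G: "fin_simple_graph G" and star: "\<And>l. l \<in> L \<Longrightarrow> {c, l} \<in> edges G"
  shows "A \<subseteq> L \<Longrightarrow> card A = i \<Longrightarrow> finite A \<Longrightarrow> c \<in> verts G \<Longrightarrow>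
    \<exists>x\<in>verts (iter_line_graph i G). vsupp i x = insert c A \<and>
      (\<forall>l\<in>L - A. \<exists>y. {x, y} \<in> edges (iter_line_graph i G) \<and>
         vsupp i x \<union> vsupp i y = insert c (insert l A))"
proof (induction i arbitrary: A)
  case 0
  then show ?case using star by auto
next
  case (Suc i)
  let ?H = "iter_line_graph i G"
  have H: "fin_simple_graph ?H" using fin_simple_graph_iter[OF G] .
  have cL: "c \<notin> L" using star G unfolding fin_simple_graph_def by fastforce
  obtain l B where B: "A = insert l B" "l \<notin> B" "card B = i" "finite B"
    using Suc.prems by (metis card_Suc_eq finite_insert)
  then obtain x where x: "x \<in> verts ?H" "vsupp i x = insert c B"
    and ex: "\<And>l. l \<in> L - B \<Longrightarrow> \<exists>y. {x, y} \<in> edges ?H \<and> vsupp i x \<union> vsupp i y = insert c (insert l B)"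
    using Suc.IH[of B] Suc.prems by auto
  obtain y where y: "{x, y} \<in> edges ?H" "vsupp i x \<union> vsupp i y = insert c A"
    using ex[of l] B Suc.prems by auto
  let ?x = "set_encode {x, y}"
  have supp: "vsupp (Suc i) (set_encode {u, v}) = vsupp i u \<union> vsupp i v" for u v
    using vsupp_encode[of "{u, v}" i] by simp
  have "\<exists>z. {?x, z} \<in> edges (iter_line_graph (Suc i) G) \<and>
      vsupp (Suc i) ?x \<union> vsupp (Suc i) z = insert c (insert m A)" if m: "m \<in> L - A" for m
  proof -
    obtain z where z: "{x, z} \<in> edges ?H" "vsupp i x \<union> vsupp i z = insert c (insert m B)"
      using ex[of m] B m by auto
    \<comment> \<open>Adjacency in the line graph requires distinct edges; the leaf \<open>m\<close>
      tells \<open>{x, z}\<close> from \<open>{x, y}\<close>.\<close>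
    have "m \<in> vsupp i x \<union> vsupp i z" "m \<notin> vsupp i x \<union> vsupp i y" using z y m cL by auto
    then have "y \<noteq> z" by blast
    then have ne: "{x, y} \<noteq> {x, z}" by (auto simp: doubleton_eq_iff)
    have "{?x, set_encode {x, z}} \<in> edges (iter_line_graph (Suc i) G)"
      unfolding edges_iter_Suc using y z ne by blast
    moreover have "vsupp (Suc i) ?x \<union> vsupp (Suc i) (set_encode {x, z}) = insert c (insert m A)"
      unfolding supp using y z B by blast
    ultimately show ?thesis by blast
  qed
  moreover have "?x \<in> verts (iter_line_graph (Suc i) G)" unfolding verts_iter_Suc using y by blast
  moreover have "vsupp (Suc i) ?x = insert c A" unfolding supp using y by simp
  ultimately show ?case by blast
qed

lemma supp_count_star_pos:
  assumes G: "fin_simple_graph G" and star: "\<And>l. l \<in> A \<Longrightarrow> {c, l} \<in> edges G"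
    and A: "finite A" "card A = i" "c \<in> verts G"
  shows "supp_count i G (insert c A) > 0"
proof -
  obtain x where "x \<in> verts (iter_line_graph i G)" "vsupp i x = insert c A"
    using star_vertex_exists[OF G star, of A A i] A by auto
  then show ?thesis
    unfolding supp_count_def using finite_verts_iter[OF G, of i] by (auto simp: card_gt_0_iff)
qed

section \<open>Caterpillars\<close>

text \<open>A tree rooted at \<open>0\<close> is encoded by its parent function. With
  \<open>f v < v\<close>, connectedness and acyclicity become arguments about the order of the
  labels.\<close>

definition parent_tree :: "nat \<Rightarrow> (nat \<Rightarrow> nat) \<Rightarrow> nat ugraph" where
  "parent_tree n f = ({..<n}, {{v, f v} | v. 0 < v \<and> v < n})"

lemma verts_parent_tree [simp]: "verts (parent_tree n f) = {..<n}"
  by (simp add: parent_tree_def)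

lemma edges_parent_tree_iff:
  "{u, v} \<in> edges (parent_tree n f) \<longleftrightarrow>
     (0 < u \<and> u < n \<and> v = f u) \<or> (0 < v \<and> v < n \<and> u = f v)"
  unfolding parent_tree_def snd_conv mem_Collect_eq doubleton_eq_iff by blast

lemma fin_simple_graph_parent_tree:
  assumes f: "\<And>v. 0 < v \<Longrightarrow> v < n \<Longrightarrow> f v < v"
  shows "fin_simple_graph (parent_tree n f)"
proof -
  have "e \<subseteq> {..<n} \<and> card e = 2" if e: "e \<in> edges (parent_tree n f)" for e
  proof -
    obtain v where v: "0 < v" "v < n" "e = {v, f v}"
      using e unfolding parent_tree_def by auto
    moreover from v f have "f v < v" by blast
    ultimately show ?thesis by auto
  qed
  then show ?thesis unfolding fin_simple_graph_def verts_parent_tree by blast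
qed

text \<open>Descending along parents connects every vertex to \<open>0\<close>. On a cycle, both
  neighbours of the largest vertex would have to be its parent, although they are distinct.\<close>

lemma is_tree_parent_tree:
  assumes n: "n > 0" and f: "\<And>v. 0 < v \<Longrightarrow> v < n \<Longrightarrow> f v < v"
  shows "is_tree (parent_tree n f)"
proof -
  let ?G = "parent_tree n f"
  have fin: "fin_simple_graph ?G" using f by (rule fin_simple_graph_parent_tree)
  have sym: "sym (adj_rel ?G)" by (auto simp: sym_def adj_rel_def insert_commute)
  have root: "(v, 0) \<in> (adj_rel ?G)\<^sup>*" if "v < n" for v
    using that
  proof (induction v rule: less_induct)
    case (less v)
    show ?case
    proof (cases "v = 0")
      case False
      then have "(v, f v) \<in> adj_rel ?G" "f v < v"
        using less.prems f by (auto simp: adj_rel_def edges_parent_tree_iff)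
      then show ?thesis using less.IH[of "f v"] less.prems by (meson converse_rtrancl_into_rtrancl less_trans)
    qed simp
  qed
  have "(u, v) \<in> (adj_rel ?G)\<^sup>*" if "u < n" "v < n" for u v
    using root[OF that(1)] root[OF that(2)] sym_rtrancl[OF sym]
    by (meson rtrancl_trans symD)
  then have conn: "connected_graph ?G" unfolding connected_graph_def using n by auto
  have "\<not> is_cycle ?G xs" for xs
  proof
    assume cyc: "is_cycle ?G xs"
    define k where "k = length xs"
    have len: "3 \<le> k" and dist: "distinct xs"
      and step: "\<And>i. Suc i < k \<Longrightarrow> {xs ! i, xs ! Suc i} \<in> edges ?G"
      and wrap: "{last xs, hd xs} \<in> edges ?G"
      using cyc unfolding is_cycle_def k_def by auto
    have wrap: "{xs ! (k - 1), xs ! 0} \<in> edges ?G"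
      using wrap len unfolding k_def by (metis hd_conv_nth last_conv_nth list.size(3) not_numeral_le_zero)
    have "set xs \<noteq> {}" using len unfolding k_def by auto
    then obtain i where i: "i < k" "xs ! i = Max (set xs)"
      unfolding k_def by (metis List.finite_set Max_in in_set_conv_nth)
    have eq: "xs ! j = f (xs ! i)" if j: "j < k" and e: "{xs ! j, xs ! i} \<in> edges ?G" for j
    proof -
      have "xs ! j \<le> xs ! i" using i j unfolding k_def by simp
      then show ?thesis using e f unfolding edges_parent_tree_iff by (metis not_le)
    qed
    \<comment> \<open>\<open>p\<close> and \<open>s\<close> are the cyclic predecessor and successor
      of the position \<open>i\<close>; they differ because a cycle has length at least 3.\<close>
    define p where "p = (if i = 0 then k - 1 else i - 1)"
    define s where "s = (if i = k - 1 then 0 else Suc i)"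
    have ps: "p < k" "s < k" "p \<noteq> s" using i len unfolding p_def s_def by auto
    have "{xs ! p, xs ! i} \<in> edges ?G"
      using wrap step[of "i - 1"] i unfolding p_def by (cases i) auto
    moreover have "{xs ! s, xs ! i} \<in> edges ?G"
      using wrap step[of i] i unfolding s_def by (auto simp: insert_commute)
    ultimately have "xs ! p = xs ! s" using eq ps by metis
    then show False using ps dist unfolding k_def by (simp add: nth_eq_iff_index_eq)
  qed
  then show ?thesis unfolding is_tree_def acyclic_graph_def using fin conn by blast
qed

text \<open>
  The spine is the path on \<open>{..<l}\<close>, divided into blocks of length \<open>2 * R + 1\<close>; every
  vertex \<open>v \<ge> l\<close> is a leaf attached to the middle of the block number \<open>g v\<close>.
\<close>

definition cat_parent :: "nat \<Rightarrow> nat \<Rightarrow> (nat \<Rightarrow> nat) \<Rightarrow> nat \<Rightarrow> nat" where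
  "cat_parent R l g v = (if v < l then v - 1 else R + g v * (2 * R + 1))"

definition caterpillar :: "nat \<Rightarrow> nat \<Rightarrow> (nat \<Rightarrow> nat) \<Rightarrow> nat \<Rightarrow> nat ugraph" where
  "caterpillar R l g n = parent_tree n (cat_parent R l g)"

text \<open>In a model caterpillar with a single block and \<open>s\<close> leaves, this counts the
  vertices of level \<open>i\<close> whose support contains all the leaves, together with any part
  of the block. The model makes the weight independent of the hub and of the surrounding
  tree.\<close>

definition leaf_weight :: "nat \<Rightarrow> nat \<Rightarrow> nat \<Rightarrow> nat" where
  "leaf_weight R i s =
     (\<Sum>P\<in>Pow {..<2 * R + 1}. supp_count i
        (caterpillar R (2 * R + 1) (\<lambda>_. 0) (2 * R + 1 + s)) (P \<union> {2 * R + 1..<2 * R + 1 + s}))"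

text \<open>The spine may run on past the \<open>K\<close> blocks and a block may carry no leaves,
  so all trees to be compared can share \<open>R\<close>, \<open>l\<close>, \<open>n\<close> and
  \<open>K\<close> and differ in \<open>g\<close> alone.\<close>

locale cat =
  fixes R l n K :: nat and g :: "nat \<Rightarrow> nat"
  assumes l_le: "l \<le> n" and blocks: "K * (2 * R + 1) \<le> l"
    and g_less: "\<And>v. l \<le> v \<Longrightarrow> v < n \<Longrightarrow> g v < K"
begin

abbreviation "W \<equiv> 2 * R + 1"
abbreviation "G \<equiv> caterpillar R l g n"

definition leaves :: "nat \<Rightarrow> nat set" where
  "leaves h = {v \<in> {l..<n}. g v = h}"

lemma block_less: "h < K \<Longrightarrow> v < W \<Longrightarrow> v + h * W < l"
proof -
  assume "h < K" "v < W"
  then have "Suc h * W \<le> K * W" by (intro mult_le_mono1) simp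
  then show ?thesis using blocks \<open>v < W\<close> by simp
qed

lemma hub_less: "l \<le> v \<Longrightarrow> v < n \<Longrightarrow> R + g v * W < l"
  using block_less[of "g v" R] g_less[of v] by simp

lemma cat_parent_less: "0 < v \<Longrightarrow> v < n \<Longrightarrow> cat_parent R l g v < v"
  using hub_less[of v] by (auto simp: cat_parent_def)

lemma fin_simple_graph_cat: "fin_simple_graph G"
  unfolding caterpillar_def by (rule fin_simple_graph_parent_tree) (rule cat_parent_less)

lemma is_tree_cat: "n > 0 \<Longrightarrow> is_tree G"
  unfolding caterpillar_def by (rule is_tree_parent_tree) (auto intro: cat_parent_less)

lemma verts_cat: "verts G = {..<n}"
  by (simp add: caterpillar_def)

lemma edges_cat_iff:
  "{u, v} \<in> edges G \<longleftrightarrow>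
     (0 < u \<and> u < n \<and> v = cat_parent R l g u) \<or> (0 < v \<and> v < n \<and> u = cat_parent R l g v)"
  by (simp only: caterpillar_def edges_parent_tree_iff)

lemma leaf_adj:
  assumes "l \<le> v" "{v, u} \<in> edges G"
  shows "u = R + g v * W"
proof -
  have "v < n" using assms(2) fin_simple_graph_cat unfolding fin_simple_graph_def verts_cat by blast
  have "\<not> (0 < u \<and> u < n \<and> v = cat_parent R l g u)"
    using assms(1) hub_less[of u] unfolding cat_parent_def by (auto split: if_splits)
  then show ?thesis using assms unfolding edges_cat_iff by (auto simp: cat_parent_def)
qed

text \<open>Retracting each leaf to its hub gives a 1-Lipschitz position \<open>p\<close> along the
  spine. By \<open>vsupp_spread\<close> the support stays within distance \<open>R\<close> of the
  hub of \<open>v\<close>, which is the middle of a block of length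
  \<open>2 * R + 1\<close>.\<close>

lemma vsupp_leaf_block:
  assumes x: "x \<in> verts (iter_line_graph i G)" and v: "v \<in> vsupp i x" "l \<le> v" and R: "2 ^ i \<le> R"
  shows "vsupp i x \<subseteq> {g v * W..<g v * W + W} \<union> leaves (g v)"
proof
  define p where "p u = (if u < l then u else R + g u * W)" for u
  fix u assume u: "u \<in> vsupp i x"
  have lip: "p a \<le> Suc (p b)" if e: "{a, b} \<in> edges G" for a b
  proof -
    have "p a = p b" if "l \<le> a"
      using leaf_adj[OF that e] hub_less[of a] e that fin_simple_graph_cat verts_cat
      unfolding p_def fin_simple_graph_def by auto
    moreover have "p a = p b" if "l \<le> b"
      using leaf_adj[OF that, of a] hub_less[of b] e that fin_simple_graph_cat verts_cat
      unfolding p_def fin_simple_graph_def by (auto simp: insert_commute)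
    moreover have ?thesis if "a < l" "b < l"
      using e that unfolding p_def edges_cat_iff cat_parent_def by auto
    ultimately show ?thesis by (metis le_SucI linorder_not_le order_refl)
  qed
  have "p u \<le> p v + 2 ^ i" "p v \<le> p u + 2 ^ i"
    using vsupp_spread[of G p, OF fin_simple_graph_cat lip x] u v by blast+
  moreover have "p v = R + g v * W" using v(2) by (simp add: p_def)
  ultimately have bd: "g v * W \<le> p u" "p u < g v * W + W" using R by linarith+
  have un: "u < n" using vsupp_props[OF fin_simple_graph_cat x] u verts_cat by blast
  show "u \<in> {g v * W..<g v * W + W} \<union> leaves (g v)"
  proof (cases "u < l")
    case True
    then show ?thesis using bd by (simp add: p_def)
  next
    case False
    then have "p u = R + g u * W" by (simp add: p_def)
    \<comment> \<open>Division by the block length recovers the block number, so a further leaf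
      \<open>u\<close> in the support hangs on the same hub as \<open>v\<close>.\<close>
    then have "p u div W = g u" by (intro div_nat_eqI) simp_all
    moreover have "p u div W = g v" using bd by (intro div_nat_eqI) (simp_all add: algebra_simps)
    ultimately show ?thesis using False un by (simp add: leaves_def)
  qed
qed

text \<open>Translating the spine of the model by \<open>h * W\<close> and matching its leaves with
  \<open>A\<close> preserves adjacency, so \<open>supp_count_iso\<close> applies.\<close>

lemma supp_count_block:
  assumes h: "h < K" and P: "P \<subseteq> {..<W}" and A: "A \<subseteq> leaves h"
  shows "supp_count i G ((\<lambda>u. u + h * W) ` P \<union> A) =
    supp_count i (caterpillar R W (\<lambda>_. 0) (W + card A)) (P \<union> {W..<W + card A})"
proof -
  interpret C: cat R W "W + card A" 1 "\<lambda>_. 0" by unfold_locales auto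
  have finA: "finite A" using A by (rule finite_subset) (simp add: leaves_def)
  then obtain b where b: "bij_betw b {W..<W + card A} A"
    using finite_same_card_bij[of "{W..<W + card A}" A] by auto
  define f where "f v = (if v < W then v + h * W else b v)" for v
  have f_leaf: "f v \<in> A" "l \<le> f v" "f v < n" "g (f v) = h" if "v \<in> {W..<W + card A}" for v
  proof -
    show "f v \<in> A" using that b by (auto simp: f_def bij_betw_def)
    then show "l \<le> f v" "f v < n" "g (f v) = h" using A by (auto simp: leaves_def)
  qed
  have f_spine: "f v = v + h * W" "f v < l" if "v < W" for v
    using that block_less[OF h that] by (auto simp: f_def)
  have img: "f ` (P \<union> {W..<W + card A}) = (\<lambda>u. u + h * W) ` P \<union> A"
  proof -
    have "f ` P = (\<lambda>u. u + h * W) ` P" using P by (intro image_cong) (auto simp: f_def)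
    moreover have "f ` {W..<W + card A} = b ` {W..<W + card A}" by (intro image_cong) (auto simp: f_def)
    ultimately show ?thesis using b by (simp add: image_Un bij_betw_def)
  qed
  have inj: "inj_on f (P \<union> {W..<W + card A})"
  proof (rule inj_onI)
    fix u v assume uv: "u \<in> P \<union> {W..<W + card A}" "v \<in> P \<union> {W..<W + card A}" "f u = f v"
    show "u = v"
    proof (cases "u < W"; cases "v < W")
      assume "\<not> u < W" "\<not> v < W"
      then show ?thesis using uv P b by (auto simp: f_def bij_betw_def inj_on_def)
    next
      assume a: "u < W" "\<not> v < W"
      then have "v \<in> {W..<W + card A}" using uv P by auto
      then show ?thesis using f_leaf(2) f_spine(2)[OF a(1)] uv(3) by fastforce
    next
      assume a: "\<not> u < W" "v < W"
      then have "u \<in> {W..<W + card A}" using uv P by auto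
      then show ?thesis using f_leaf(2) f_spine(2)[OF a(2)] uv(3) by fastforce
    qed (use uv(3) in \<open>simp add: f_def\<close>)
  qed
  \<comment> \<open>The delicate vertex is \<open>0\<close>: it has no parent in the model, while
    its image \<open>h * W\<close> has one if \<open>h > 0\<close>. That parent is
    \<open>h * W - 1\<close>, which lies outside the image.\<close>
  have par: "0 < u \<and> u < W + card A \<and> v = cat_parent R W (\<lambda>_. 0) u \<longleftrightarrow>
      0 < f u \<and> f u < n \<and> f v = cat_parent R l g (f u)"
    if "u \<in> P \<union> {W..<W + card A}" "v \<in> P \<union> {W..<W + card A}" for u v
  proof -
    have u: "u < W \<or> u \<in> {W..<W + card A}" and v: "v < W \<or> v \<in> {W..<W + card A}"
      using that P by auto
    show ?thesis
    proof (cases "u < W")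
      case True
      have fu: "f u = u + h * W" "f u < l" "f u < n" using f_spine[OF True] l_le by auto
      show ?thesis
      proof (cases "v < W")
        case vW: True
        show ?thesis using fu True f_spine[OF vW] by (auto simp: cat_parent_def)
      next
        case False
        then have "l \<le> f v" using v f_leaf by blast
        then show ?thesis using fu True False by (auto simp: cat_parent_def)
      qed
    next
      case False
      then have u: "u \<in> {W..<W + card A}" using u by blast
      have fu: "cat_parent R l g (f u) = R + h * W" "f u < n" "0 < f u"
        using f_leaf[OF u] block_less[OF h, of R] by (auto simp: cat_parent_def)
      show ?thesis
      proof (cases "v < W")
        case vW: True
        show ?thesis using fu u f_spine[OF vW] by (auto simp: cat_parent_def)
      next
        case False
        then have "l \<le> f v" using v f_leaf by blast
        moreover have "R + h * W < l" using block_less[OF h, of R] by simp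
        ultimately show ?thesis using fu u False by (auto simp: cat_parent_def)
      qed
    qed
  qed
  have "supp_count i (caterpillar R W (\<lambda>_. 0) (W + card A)) (P \<union> {W..<W + card A}) =
      supp_count i G (f ` (P \<union> {W..<W + card A}))"
  proof (rule supp_count_iso[OF C.fin_simple_graph_cat fin_simple_graph_cat _ _ inj])
    show "P \<union> {W..<W + card A} \<subseteq> verts (caterpillar R W (\<lambda>_. 0) (W + card A))"
      unfolding C.verts_cat using P by auto
    show "f ` (P \<union> {W..<W + card A}) \<subseteq> verts G"
      unfolding verts_cat using f_leaf(3) f_spine(2) P l_le by fastforce
    show "{u, v} \<in> edges (caterpillar R W (\<lambda>_. 0) (W + card A)) \<longleftrightarrow> {f u, f v} \<in> edges G"
      if "u \<in> P \<union> {W..<W + card A}" "v \<in> P \<union> {W..<W + card A}" for u v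
      unfolding C.edges_cat_iff edges_cat_iff using par[OF that] par[OF that(2,1)] by blast
  qed
  then show ?thesis by (simp only: img)
qed

end

section \<open>Line graph sizes of caterpillars\<close>

text \<open>A support with \<open>s\<close> leaves also contains their hub, hence has at least
  \<open>s + 1\<close> elements, more than the \<open>i + 1\<close> allowed by
  \<open>card_vsupp_le\<close>. At level 0 a single leaf would be a support without its hub.\<close>

lemma leaf_weight_eq_0:
  assumes i: "i > 0" and s: "s > i"
  shows "leaf_weight R i s = 0"
  unfolding leaf_weight_def
proof (rule sum.neutral, rule ballI)
  let ?W = "2 * R + 1"
  interpret C: cat R ?W "?W + s" 1 "\<lambda>_. 0" by unfold_locales auto
  fix P assume P: "P \<in> Pow {..<?W}"
  show "supp_count i C.G (P \<union> {?W..<?W + s}) = 0"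
  proof (rule supp_count_eq_0I)
    fix x assume x: "x \<in> verts (iter_line_graph i C.G)"
    show "vsupp i x \<noteq> P \<union> {?W..<?W + s}"
    proof
      assume eq: "vsupp i x = P \<union> {?W..<?W + s}"
      obtain j where j: "i = Suc j" using i by (cases i) auto
      have "?W \<in> vsupp i x" using eq s by auto
      then obtain u where u: "u \<in> vsupp i x" "{?W, u} \<in> edges C.G"
        using vsupp_no_isolated[OF C.fin_simple_graph_cat x[unfolded j]] unfolding j by blast
      have "u = R" using C.leaf_adj[OF order_refl u(2)] by simp
      then have "insert R {?W..<?W + s} \<subseteq> vsupp i x" using u eq by auto
      then have "card (insert R {?W..<?W + s}) \<le> card (vsupp i x)"
        using vsupp_props[OF C.fin_simple_graph_cat x] by (intro card_mono) auto
      then show False using card_vsupp_le[OF C.fin_simple_graph_cat x] s by simp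
    qed
  qed
qed

text \<open>The summand with \<open>P = {R}\<close> counts the vertices supported on the star formed
  by the hub and its \<open>i\<close> leaves, and such a vertex exists.\<close>

lemma leaf_weight_pos: "leaf_weight R i i > 0"
proof -
  let ?W = "2 * R + 1"
  interpret C: cat R ?W "?W + i" 1 "\<lambda>_. 0" by unfold_locales auto
  have "{R, v} \<in> edges C.G" if "v \<in> {?W..<?W + i}" for v
    unfolding C.edges_cat_iff using that by (auto simp: cat_parent_def)
  then have "supp_count i C.G (insert R {?W..<?W + i}) > 0"
    by (intro supp_count_star_pos[OF C.fin_simple_graph_cat]) (auto simp only: C.verts_cat, auto)
  then have "supp_count i C.G ({R} \<union> {?W..<?W + i}) > 0" by simp
  then show ?thesis
    unfolding leaf_weight_def by (intro sum_pos2[of _ "{R}"]) auto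
qed

lemma sum_nonempty_subsets_card:
  fixes w :: "nat \<Rightarrow> nat"
  assumes L: "finite L" and w: "\<And>s. s > i \<Longrightarrow> w s = 0"
  shows "(\<Sum>A\<in>Pow L - {{}}. w (card A)) = (\<Sum>s=1..i. (card L choose s) * w s)"
proof -
  let ?S = "Pow L - {{}}"
  \<comment> \<open>The range up to \<open>card L + i\<close> contains both the sizes that occur and
    \<open>{1..i}\<close>; the terms beyond \<open>i\<close> vanish with \<open>w\<close>.\<close>
  have "(\<Sum>A\<in>?S. w (card A)) = (\<Sum>s\<in>{1..card L + i}. \<Sum>A\<in>{A \<in> ?S. card A = s}. w (card A))"
  proof (rule sum.group[symmetric])
    show "card ` ?S \<subseteq> {1..card L + i}"
    proof
      fix s assume "s \<in> card ` ?S"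
      then obtain A where A: "A \<subseteq> L" "A \<noteq> {}" "s = card A" by blast
      then have "0 < card A" "card A \<le> card L"
        using L by (auto simp: card_gt_0_iff card_mono intro: finite_subset)
      then show "s \<in> {1..card L + i}" using A by auto
    qed
  qed (use L in auto)
  also have "\<dots> = (\<Sum>s\<in>{1..card L + i}. (card L choose s) * w s)"
  proof (rule sum.cong[OF refl])
    fix s assume "s \<in> {1..card L + i}"
    then have "{A \<in> ?S. card A = s} = {A. A \<subseteq> L \<and> card A = s}" by auto
    moreover have "(\<Sum>A\<in>{A \<in> ?S. card A = s}. w (card A)) = card {A \<in> ?S. card A = s} * w s"
      by simp
    ultimately show "(\<Sum>A\<in>{A \<in> ?S. card A = s}. w (card A)) = (card L choose s) * w s"
      by (simp add: n_subsets[OF L])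
  qed
  also have "\<dots> = (\<Sum>s=1..i. (card L choose s) * w s)"
    by (rule sum.mono_neutral_right) (use w in auto)
  finally show ?thesis .
qed

lemma Un_disjoint_inject:
  assumes "X \<union> A = Y \<union> B" "X \<subseteq> C" "Y \<subseteq> C" "A \<subseteq> D" "B \<subseteq> D" "C \<inter> D = {}"
  shows "X = Y \<and> A = B"
  using assms by blast

context cat
begin

lemma finite_leaves: "finite (leaves h)"
  by (simp add: leaves_def)

text \<open>Supports inside the spine therefore contribute a number that depends only on
  \<open>i\<close> and \<open>l\<close>; it cancels when two choices of \<open>g\<close> are
  compared.\<close>

lemma induced_spine: "induced G {..<l} = parent_tree l (\<lambda>v. v - 1)"
proof -
  have "{e \<in> edges G. e \<subseteq> {..<l}} = edges (parent_tree l (\<lambda>v. v - 1))"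
    (is "?A = ?B")
  proof (intro equalityI subsetI)
    fix e assume "e \<in> ?A"
    then obtain v where v: "0 < v" "v < n" "e = {v, cat_parent R l g v}" "e \<subseteq> {..<l}"
      unfolding caterpillar_def parent_tree_def by auto
    then have "e = {v, v - 1}" "v < l" by (auto simp: cat_parent_def)
    then show "e \<in> ?B" using v(1) unfolding parent_tree_def by auto
  next
    fix e assume "e \<in> ?B"
    then obtain v where v: "0 < v" "v < l" "e = {v, v - 1}" unfolding parent_tree_def by auto
    then have "e = {v, cat_parent R l g v}" "v < n" using l_le by (auto simp: cat_parent_def)
    moreover have "e \<subseteq> {..<l}" using v by auto
    ultimately show "e \<in> ?A" using v(1) unfolding caterpillar_def parent_tree_def by auto
  qed
  then show ?thesis by (simp add: induced_def prod_eq_iff)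
qed

text \<open>By \<open>vsupp_leaf_block\<close> a support either lies in the spine or meets the
  leaves of exactly one hub \<open>h\<close> and stays in its block and its leaves. The families
  \<open>F h\<close> collect the sets of the second kind; every other set has support count
  0.\<close>

lemma card_verts_iter_cat:
  assumes i: "i > 0" and R: "2 ^ i \<le> R"
  shows "card (verts (iter_line_graph i G)) =
    card (verts (iter_line_graph i (parent_tree l (\<lambda>v. v - 1)))) +
    (\<Sum>h<K. \<Sum>s=1..i. (card (leaves h) choose s) * leaf_weight R i s)"
proof -
  define F where "F h = {T. T \<subseteq> {h * W..<h * W + W} \<union> leaves h \<and> T \<inter> leaves h \<noteq> {}}" for h
  have block_sub: "{h * W..<h * W + W} \<subseteq> {..<l}" if "h < K" for h
    using block_less[OF that, of "W - 1"] by auto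
  have finF: "finite (F h)" for h
    by (rule finite_subset[of _ "Pow ({h * W..<h * W + W} \<union> leaves h)"])
      (auto simp: F_def finite_leaves)
  have Fsub: "F h \<subseteq> Pow {..<n}" if "h < K" for h
    using block_sub[OF that] l_le unfolding F_def leaves_def by fastforce
  have Fspine: "F h \<inter> Pow {..<l} = {}" for h
    unfolding F_def leaves_def by fastforce
  have Fdisj: "F h \<inter> F h' = {}" if "h < K" "h' < K" "h \<noteq> h'" for h h'
  proof (rule ccontr)
    assume "F h \<inter> F h' \<noteq> {}"
    then obtain T v where "v \<in> T" "v \<in> leaves h" "T \<subseteq> {h' * W..<h' * W + W} \<union> leaves h'"
      unfolding F_def by blast
    then show False using block_sub[OF that(2)] that(3) unfolding leaves_def by fastforce
  qed
  have zero: "supp_count i G T = 0" if T: "T \<in> Pow {..<n} - (Pow {..<l} \<union> (\<Union>h<K. F h))" for T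
  proof (rule supp_count_eq_0I)
    fix x assume x: "x \<in> verts (iter_line_graph i G)"
    show "vsupp i x \<noteq> T"
    proof
      assume eq: "vsupp i x = T"
      obtain v where v: "v \<in> T" "l \<le> v" "v < n" using T by fastforce
      have "T \<subseteq> {g v * W..<g v * W + W} \<union> leaves (g v)"
        using vsupp_leaf_block[OF x _ v(2) R] v(1) eq by blast
      then have "T \<in> F (g v)" using v by (auto simp: F_def leaves_def)
      then show False using T g_less[OF v(2,3)] by blast
    qed
  qed
  have "card (verts (iter_line_graph i G)) = (\<Sum>T\<in>Pow {..<n}. supp_count i G T)"
    using card_verts_iter_induced[OF fin_simple_graph_cat, of "{..<n}" i]
      induced_verts[OF fin_simple_graph_cat] verts_cat by simp
  also have "\<dots> = (\<Sum>T\<in>Pow {..<l} \<union> (\<Union>h<K. F h). supp_count i G T)"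
    by (rule sum.mono_neutral_right) (use Fsub l_le zero in \<open>auto simp: subset_iff\<close>)
  also have "\<dots> = (\<Sum>T\<in>Pow {..<l}. supp_count i G T) + (\<Sum>T\<in>(\<Union>h<K. F h). supp_count i G T)"
    by (rule sum.union_disjoint) (use Fspine finF in auto)
  also have "(\<Sum>T\<in>Pow {..<l}. supp_count i G T) =
      card (verts (iter_line_graph i (parent_tree l (\<lambda>v. v - 1))))"
    using card_verts_iter_induced[OF fin_simple_graph_cat, of "{..<l}" i] l_le
    by (simp add: verts_cat induced_spine)
  also have "(\<Sum>T\<in>(\<Union>h<K. F h). supp_count i G T) = (\<Sum>h<K. \<Sum>T\<in>F h. supp_count i G T)"
    by (rule sum.UNION_disjoint) (use Fdisj finF in auto)
  also have "\<dots> = (\<Sum>h<K. \<Sum>s=1..i. (card (leaves h) choose s) * leaf_weight R i s)"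
  proof (rule sum.cong[OF refl])
    fix h assume "h \<in> {..<K}"
    then have h: "h < K" by simp
    let ?sh = "\<lambda>u. u + h * W"
    \<comment> \<open>A member of \<open>F h\<close> is split into its nonempty set \<open>A\<close>
      of leaves and its part of the block, translated back to a subset \<open>P\<close> of
      \<open>{..<W}\<close>.\<close>
    let ?D = "(Pow (leaves h) - {{}}) \<times> Pow {..<W}"
    let ?j = "\<lambda>(A, P). ?sh ` P \<union> A"
    have shW: "?sh ` {..<W} = {h * W..<h * W + W}"
      by (metis add.commute add_0 image_add_atLeastLessThan' lessThan_atLeast0)
    have shP: "?sh ` P \<subseteq> {h * W..<h * W + W}" if "P \<subseteq> {..<W}" for P
      using image_mono[OF that] by (simp only: shW[symmetric])
    have disj: "{h * W..<h * W + W} \<inter> leaves h = {}" using block_sub[OF h] unfolding leaves_def by fastforce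
    have bij: "bij_betw ?j ?D (F h)"
    proof (rule bij_betw_imageI)
      show "inj_on ?j ?D"
      proof (rule inj_onI)
        fix z z' assume z: "z \<in> ?D" "z' \<in> ?D" "?j z = ?j z'"
        obtain A P A' P' where zz: "z = (A, P)" "z' = (A', P')" by (metis surj_pair)
        have a: "A \<subseteq> leaves h" "P \<subseteq> {..<W}" "A' \<subseteq> leaves h" "P' \<subseteq> {..<W}"
          and eq: "?sh ` P \<union> A = ?sh ` P' \<union> A'"
          using z unfolding zz by auto
        have "?sh ` P \<subseteq> {h * W..<h * W + W}" "?sh ` P' \<subseteq> {h * W..<h * W + W}"
          using shP a by simp_all
        then have "?sh ` P = ?sh ` P' \<and> A = A'"
          by (rule Un_disjoint_inject[OF eq _ _ a(1,3) disj])
        then show "z = z'" unfolding zz by (simp add: inj_image_eq_iff inj_def)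
      qed
      show "?j ` ?D = F h"
      proof (intro equalityI subsetI)
        fix T assume "T \<in> ?j ` ?D"
        then obtain A P where T: "T = ?sh ` P \<union> A" "A \<subseteq> leaves h" "A \<noteq> {}" "P \<subseteq> {..<W}" by auto
        then have "?sh ` P \<subseteq> {h * W..<h * W + W}" using shP by simp
        then show "T \<in> F h" using T unfolding F_def by blast
      next
        fix T assume T: "T \<in> F h"
        then have "T \<inter> {h * W..<h * W + W} \<subseteq> ?sh ` {..<W}" using shW by simp
        then obtain P where P: "P \<subseteq> {..<W}" "T \<inter> {h * W..<h * W + W} = ?sh ` P"
          by (auto simp only: subset_image_iff)
        have "T = ?j (T \<inter> leaves h, P)" using T P(2) unfolding F_def by auto
        moreover have "(T \<inter> leaves h, P) \<in> ?D" using T P(1) unfolding F_def by auto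
        ultimately show "T \<in> ?j ` ?D" by blast
      qed
    qed
    have "(\<Sum>T\<in>F h. supp_count i G T) = (\<Sum>(A, P)\<in>?D. supp_count i G (?sh ` P \<union> A))"
      using sum.reindex_bij_betw[OF bij, of "supp_count i G"] by (simp add: case_prod_unfold)
    also have "\<dots> = (\<Sum>A\<in>Pow (leaves h) - {{}}. \<Sum>P\<in>Pow {..<W}. supp_count i G (?sh ` P \<union> A))"
      by (rule sum.cartesian_product[symmetric])
    \<comment> \<open>By \<open>supp_count_block\<close> the inner sum depends on \<open>A\<close>
      only through its size.\<close>
    also have "\<dots> = (\<Sum>A\<in>Pow (leaves h) - {{}}. leaf_weight R i (card A))"
      unfolding leaf_weight_def by (intro sum.cong refl supp_count_block[OF h]) auto
    also have "\<dots> = (\<Sum>s=1..i. (card (leaves h) choose s) * leaf_weight R i s)"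
      by (rule sum_nonempty_subsets_card[OF finite_leaves]) (rule leaf_weight_eq_0[OF i])
    finally show "(\<Sum>T\<in>F h. supp_count i G T) =
        (\<Sum>s=1..i. (card (leaves h) choose s) * leaf_weight R i s)" .
  qed
  finally show ?thesis .
qed

end

text \<open>
  The coefficient of \<open>\<Sum>h. card (leaves h) choose i\<close> in the number of vertices of the
  \<open>i\<close>-th line graph is positive, and the other coefficients only involve smaller indices.
\<close>

lemma binomial_sums_determined:
  assumes c: "cat R l n K g" and c': "cat R l n K g'" and R: "2 ^ k \<le> R"
    and eq: "graham_equiv (caterpillar R l g n) (caterpillar R l g' n)"
  shows "0 < i \<Longrightarrow> i \<le> k \<Longrightarrow>
    (\<Sum>h<K. card (cat.leaves l n g h) choose i) = (\<Sum>h<K. card (cat.leaves l n g' h) choose i)"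
proof (induction i rule: less_induct)
  case (less i)
  let ?B = "\<lambda>g s. \<Sum>h<K. card (cat.leaves l n g h) choose s"
  let ?w = "leaf_weight R i"
  have "(2::nat) ^ i \<le> 2 ^ k" using less.prems by (intro power_increasing) auto
  then have R: "2 ^ i \<le> R" using R by (rule order_trans)
  have sw: "(\<Sum>h<K. \<Sum>s=1..i. (card (cat.leaves l n g h) choose s) * ?w s) =
      (\<Sum>s=1..<i. ?B g s * ?w s) + ?B g i * ?w i" for g
  proof -
    have "(\<Sum>h<K. \<Sum>s=1..i. (card (cat.leaves l n g h) choose s) * ?w s) = (\<Sum>s=1..i. ?B g s * ?w s)"
      by (subst sum.swap) (simp add: sum_distrib_right)
    also have "\<dots> = (\<Sum>s\<in>insert i {1..<i}. ?B g s * ?w s)"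
      using less.prems by (intro sum.cong) auto
    finally show ?thesis by simp
  qed
  have "(\<Sum>s=1..<i. ?B g s * ?w s) = (\<Sum>s=1..<i. ?B g' s * ?w s)"
    using less.IH less.prems by (intro sum.cong refl) auto
  moreover have "card (verts (iter_line_graph i (caterpillar R l g n))) =
      card (verts (iter_line_graph i (caterpillar R l g' n)))"
    using eq unfolding graham_equiv_def by blast
  ultimately have "?B g i * ?w i = ?B g' i * ?w i"
    using cat.card_verts_iter_cat[OF c less.prems(1) R] cat.card_verts_iter_cat[OF c' less.prems(1) R] sw
    by simp
  then show ?case using leaf_weight_pos[of R i] by simp
qed

text \<open>Grouping hubs by their value \<open>j\<close>, the \<open>m\<close>-th sum is a
  combination of the multiplicities of \<open>j = m..k\<close> in which that of \<open>m\<close> has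
  coefficient 1. Downward induction from \<open>k\<close> solves this triangular system.\<close>

lemma binomial_sums_inject:
  fixes d d' :: "nat \<Rightarrow> nat"
  assumes bd: "\<And>h. h < K \<Longrightarrow> d h \<le> k" "\<And>h. h < K \<Longrightarrow> d' h \<le> k"
    and eq: "\<And>i. 0 < i \<Longrightarrow> i \<le> k \<Longrightarrow> (\<Sum>h<K. d h choose i) = (\<Sum>h<K. d' h choose i)"
  shows "0 < m \<Longrightarrow> m \<le> k \<Longrightarrow> card {h\<in>{..<K}. d h = m} = card {h\<in>{..<K}. d' h = m}"
proof (induction "k - m" arbitrary: m rule: less_induct)
  case less
  have grp: "(\<Sum>h<K. d h choose m) =
      card {h\<in>{..<K}. d h = m} + (\<Sum>j\<in>{m<..k}. card {h\<in>{..<K}. d h = j} * (j choose m))"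
    if "\<And>h. h < K \<Longrightarrow> d h \<le> k" for d :: "nat \<Rightarrow> nat"
  proof -
    have "(\<Sum>h<K. d h choose m) = (\<Sum>j\<in>{..k}. \<Sum>h\<in>{h\<in>{..<K}. d h = j}. d h choose m)"
      by (rule sum.group[symmetric]) (use that in auto)
    also have "\<dots> = (\<Sum>j\<in>{..k}. card {h\<in>{..<K}. d h = j} * (j choose m))"
      by (rule sum.cong) auto
    also have "\<dots> = (\<Sum>j\<in>insert m {m<..k}. card {h\<in>{..<K}. d h = j} * (j choose m))"
      by (rule sum.mono_neutral_right) (use less.prems in auto)
    finally show ?thesis by simp
  qed
  have "(\<Sum>j\<in>{m<..k}. card {h\<in>{..<K}. d h = j} * (j choose m)) =
      (\<Sum>j\<in>{m<..k}. card {h\<in>{..<K}. d' h = j} * (j choose m))"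
  proof (rule sum.cong[OF refl])
    fix j assume "j \<in> {m<..k}"
    then show "card {h\<in>{..<K}. d h = j} * (j choose m) = card {h\<in>{..<K}. d' h = j} * (j choose m)"
      using less.hyps[of j] by auto
  qed
  then show ?case using grp[OF bd(1)] grp[OF bd(2)] eq[OF less.prems] by simp
qed

section \<open>Counting Graham classes\<close>

lemma finite_trees_on: "finite (trees_on n)"
proof (rule finite_subset)
  show "trees_on n \<subseteq> {{..<n}} \<times> Pow (Pow {..<n})"
    unfolding trees_on_def is_tree_def fin_simple_graph_def by (fastforce simp: prod_eq_iff)
qed simp

text \<open>Since \<open>card\<close> is 0 on infinite sets, finiteness is what turns an injection
  into the set of classes into a lower bound.\<close>

lemma finite_graham_classes: "finite (graham_classes n)"
  unfolding graham_classes_def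
proof (rule finite_quotient)
  show "finite (tree_iso_classes n)"
    unfolding tree_iso_classes_def by (rule finite_quotient) (auto intro: finite_trees_on)
qed auto

text \<open>Graham equivalence is invariant under isomorphism, so if some members of two isomorphism
  classes are equivalent, the chosen trees \<open>T a\<close> and \<open>T b\<close> are
  too.\<close>

lemma card_le_graham_classes:
  assumes T: "\<And>a. a \<in> P \<Longrightarrow> T a \<in> trees_on n"
    and inj: "\<And>a b. a \<in> P \<Longrightarrow> b \<in> P \<Longrightarrow> graham_equiv (T a) (T b) \<Longrightarrow> a = b"
  shows "card P \<le> card (graham_classes n)"
proof -
  define r where "r = {(G, H). G \<in> trees_on n \<and> H \<in> trees_on n \<and> graph_iso G H}"
  define q where "q = {(X, Y). X \<in> tree_iso_classes n \<and> Y \<in> tree_iso_classes n \<and>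
                (\<exists>G\<in>X. \<exists>H\<in>Y. graham_equiv G H)}"
  define X where "X a = r `` {T a}" for a
  have X: "X a \<in> tree_iso_classes n" if "a \<in> P" for a
    unfolding X_def tree_iso_classes_def r_def[symmetric] using T[OF that] by (rule quotientI)
  have "graph_iso G G" for G :: "nat ugraph"
    unfolding graph_iso_def by (rule exI[of _ id]) simp
  then have TX: "T a \<in> X a" if "a \<in> P" for a
    using T[OF that] unfolding X_def r_def by blast
  have iso: "graham_equiv (T a) G" if "G \<in> X a" for a G
  proof -
    have "T a \<in> trees_on n" "G \<in> trees_on n" "graph_iso (T a) G" using that unfolding X_def r_def by auto
    then show ?thesis unfolding graham_equiv_def trees_on_def is_tree_def
      using card_verts_iter_iso by blast
  qed
  have refl: "(X a, X a) \<in> q" if "a \<in> P" for a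
    unfolding q_def using X[OF that] TX[OF that] by (auto simp: graham_equiv_def)
  have "inj_on (\<lambda>a. q `` {X a}) P"
  proof (rule inj_onI)
    fix a b assume ab: "a \<in> P" "b \<in> P" "q `` {X a} = q `` {X b}"
    \<comment> \<open>\<open>X b\<close> lies in its own image under \<open>q\<close>, hence in that
      of \<open>X a\<close>.\<close>
    then have "(X a, X b) \<in> q" using refl[of b] by blast
    then obtain G H where GH: "G \<in> X a" "H \<in> X b" "graham_equiv G H" unfolding q_def by auto
    then have "graham_equiv (T a) (T b)"
      using iso[OF GH(1)] iso[OF GH(2)] unfolding graham_equiv_def by simp
    then show "a = b" using inj ab by blast
  qed
  moreover have "(\<lambda>a. q `` {X a}) ` P \<subseteq> graham_classes n"
    unfolding graham_classes_def q_def[symmetric] using X by (auto intro: quotientI)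
  ultimately show ?thesis using finite_graham_classes by (rule card_inj_on_le)
qed

section \<open>Leaf assignments with prescribed multiplicities\<close>

lemma exists_list_with_counts:
  "\<exists>xs. set xs \<subseteq> {2..k} \<and> (\<forall>m\<in>{2..k}. count_list xs m = a m) \<and> sum_list xs = (\<Sum>m=2..k. m * a m)"
proof (induction k)
  case 0
  show ?case by (rule exI[of _ "[]"]) simp
next
  case (Suc k)
  then obtain xs where xs: "set xs \<subseteq> {2..k}" "\<forall>m\<in>{2..k}. count_list xs m = a m"
    "sum_list xs = (\<Sum>m=2..k. m * a m)" by blast
  show ?case
  proof (cases "2 \<le> Suc k")
    case True
    have rep: "count_list (replicate j (Suc k)) m = (if m = Suc k then j else 0)" for j m
      by (induction j) auto
    have "count_list xs (Suc k) = 0" using xs(1) by (intro count_notin) auto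
    then show ?thesis using xs True
      by (intro exI[of _ "xs @ replicate (a (Suc k)) (Suc k)"]) (auto simp: rep sum_list_replicate)
  next
    case False
    then show ?thesis by (intro exI[of _ "[]"]) auto
  qed
qed

lemma exists_fibres_of_sizes:
  "\<exists>g. (\<forall>v\<in>{l..<l + sum_list xs}. g v < length xs) \<and>
     (\<forall>h<length xs. card {v\<in>{l..<l + sum_list xs}. g v = h} = xs ! h)"
proof (induction xs rule: rev_induct)
  case (snoc x xs)
  let ?s = "l + sum_list xs"
  obtain g where g: "\<And>v. v \<in> {l..<?s} \<Longrightarrow> g v < length xs"
      "\<And>h. h < length xs \<Longrightarrow> card {v\<in>{l..<?s}. g v = h} = xs ! h"
    using snoc by blast
  define g' where "g' v = (if v < ?s then g v else length xs)" for v
  have "{v\<in>{l..<?s + x}. g' v = h} = {v\<in>{l..<?s}. g v = h}" if "h < length xs" for h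
    using that by (auto simp: g'_def)
  moreover have "{v\<in>{l..<?s + x}. g' v = length xs} = {?s..<?s + x}"
  proof (intro equalityI subsetI)
    fix v assume "v \<in> {v\<in>{l..<?s + x}. g' v = length xs}"
    then show "v \<in> {?s..<?s + x}" using g(1)[of v] by (cases "v < ?s") (auto simp: g'_def)
  qed (simp add: g'_def)
  ultimately have "card {v\<in>{l..<?s + x}. g' v = h} = (xs @ [x]) ! h" if "h < Suc (length xs)" for h
    using that g(2)[of h] by (cases "h = length xs") (auto simp: nth_append)
  moreover have "g' v < Suc (length xs)" if "v \<in> {l..<?s + x}" for v
    using that g(1)[of v] by (auto simp: g'_def)
  ultimately show ?case by (intro exI[of _ g']) (simp add: add.assoc)
qed simp

text \<open>Each of the \<open>k - 1\<close> values \<open>m\<close> uses at most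
  \<open>k * B\<close> leaves, so \<open>M\<close> leaves suffice. Only the values from 2 on are
  prescribed: hubs with one or no leaf serve as padding, so that every \<open>a\<close> leads to the
  same number \<open>M\<close> of leaves and of hubs.\<close>

lemma exists_leaf_assignment:
  assumes k: "k > 0" and a: "\<And>m. m \<in> {2..k} \<Longrightarrow> a m < B" and M: "M = k\<^sup>2 * B"
  shows "\<exists>g. (\<forall>v\<in>{l..<l + M}. g v < M) \<and>
     (\<forall>h<M. card {v\<in>{l..<l + M}. g v = h} \<le> k) \<and>
     (\<forall>m\<in>{2..k}. card {h\<in>{..<M}. card {v\<in>{l..<l + M}. g v = h} = m} = a m)"
proof -
  obtain ys where ys: "set ys \<subseteq> {2..k}" "\<forall>m\<in>{2..k}. count_list ys m = a m"
    "sum_list ys = (\<Sum>m=2..k. m * a m)" using exists_list_with_counts by blast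
  have "(\<Sum>m=2..k. m * a m) \<le> (\<Sum>m=2..k. k * B)"
    using a by (intro sum_mono mult_le_mono) (auto intro: less_imp_le)
  also have "\<dots> = (k - 1) * (k * B)" by simp
  also have "\<dots> \<le> k * (k * B)" by (intro mult_le_mono1) simp
  finally have sM: "sum_list ys \<le> M" using ys(3) M by (simp add: power2_eq_square)
  have "length ys \<le> sum_list ys" using ys(1) by (induction ys) auto
  \<comment> \<open>The ones raise the sum to \<open>M\<close>; the zeros then raise the length to
    \<open>M\<close>. Neither affects the counts of values from 2 on.\<close>
  define xs where "xs = ys @ replicate (M - sum_list ys) 1 @ replicate (sum_list ys - length ys) 0"
  have xs: "length xs = M" "sum_list xs = M"
    using sM \<open>length ys \<le> sum_list ys\<close> by (auto simp: xs_def sum_list_replicate)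
  have rep: "count_list (replicate j b) m = 0" if "m \<noteq> b" for j m and b :: nat
    using that by (intro count_notin) auto
  have cnt: "count_list xs m = a m" if "m \<in> {2..k}" for m
    using that ys(2) by (auto simp: xs_def rep)
  have le: "xs ! h \<le> k" if "h < M" for h
  proof -
    have "xs ! h \<in> set xs" using that xs(1) by simp
    then show ?thesis using ys(1) k unfolding xs_def by (auto split: if_splits)
  qed
  obtain g where g: "\<forall>v\<in>{l..<l + M}. g v < M" "\<forall>h<M. card {v\<in>{l..<l + M}. g v = h} = xs ! h"
    using exists_fibres_of_sizes[of l xs] xs by auto
  have "card {h\<in>{..<M}. card {v\<in>{l..<l + M}. g v = h} = m} = a m" if "m \<in> {2..k}" for m
  proof -
    have "{h\<in>{..<M}. card {v\<in>{l..<l + M}. g v = h} = m} = {h. h < length xs \<and> m = xs ! h}"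
      using g(2) xs(1) by auto
    then have "card {h\<in>{..<M}. card {v\<in>{l..<l + M}. g v = h} = m} = count_list xs m"
      by (simp add: count_list_eq_length_filter length_filter_conv_card)
    then show ?thesis using cnt[OF that] by simp
  qed
  then show ?thesis using g le by auto
qed

text \<open>Each of the \<open>B ^ (k - 1)\<close> functions from \<open>{2..k}\<close> to
  \<open>{..<B}\<close> yields a caterpillar from whose line graph sizes it can be recovered. The
  bound on \<open>n\<close> makes room for \<open>M\<close> blocks of length
  \<open>2 * 2 ^ k + 1\<close> and \<open>M\<close> leaves; surplus vertices lengthen the
  spine.\<close>

lemma graham_classes_lower_bound:
  assumes k: "k > 0" and B: "B > 0" and n: "k\<^sup>2 * B * (2 * 2 ^ k + 2) \<le> n"
  shows "B ^ (k - 1) \<le> card (graham_classes n)"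
proof -
  define M where "M = k\<^sup>2 * B"
  define R :: nat where "R = 2 ^ k"
  define l where "l = n - M"
  have "M * (2 * R + 1) + M \<le> n" using n by (simp add: M_def R_def algebra_simps)
  then have l: "M * (2 * R + 1) \<le> l" "n = l + M" by (simp_all add: l_def)
  have n0: "n > 0" using l(2) k B by (simp add: M_def)
  let ?P = "PiE {2..k} (\<lambda>_. {..<B})"
  define Q where "Q a g \<longleftrightarrow> (\<forall>v\<in>{l..<n}. g v < M) \<and>
     (\<forall>h<M. card {v\<in>{l..<n}. g v = h} \<le> k) \<and>
     (\<forall>m\<in>{2..k}. card {h\<in>{..<M}. card {v\<in>{l..<n}. g v = h} = m} = a m)" for a g
  have "\<exists>g. Q a g" if "a \<in> ?P" for a
    unfolding Q_def l(2) by (rule exists_leaf_assignment[OF k _ M_def]) (use that in auto)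
  then obtain g where Q: "\<And>a. a \<in> ?P \<Longrightarrow> Q a (g a)"
    using bchoice[of ?P Q] by blast
  have g: "\<And>a v. a \<in> ?P \<Longrightarrow> v \<in> {l..<n} \<Longrightarrow> g a v < M"
    "\<And>a h. a \<in> ?P \<Longrightarrow> h < M \<Longrightarrow> card {v\<in>{l..<n}. g a v = h} \<le> k"
    "\<And>a m. a \<in> ?P \<Longrightarrow> m \<in> {2..k} \<Longrightarrow>
       card {h\<in>{..<M}. card {v\<in>{l..<n}. g a v = h} = m} = a m"
    using Q unfolding Q_def by blast+
  have c: "cat R l n M (g a)" if "a \<in> ?P" for a
    by unfold_locales (use l g(1)[OF that] in auto)
  have "card ?P \<le> card (graham_classes n)"
  proof (rule card_le_graham_classes)
    fix a assume a: "a \<in> ?P"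
    show "caterpillar R l (g a) n \<in> trees_on n"
      unfolding trees_on_def using cat.is_tree_cat[OF c[OF a] n0] cat.verts_cat[OF c[OF a]] by simp
  next
    fix a b assume a: "a \<in> ?P" and b: "b \<in> ?P"
      and eq: "graham_equiv (caterpillar R l (g a) n) (caterpillar R l (g b) n)"
    have sums: "(\<Sum>h<M. card {v\<in>{l..<n}. g a v = h} choose i) =
        (\<Sum>h<M. card {v\<in>{l..<n}. g b v = h} choose i)" if "0 < i" "i \<le> k" for i
      using binomial_sums_determined[OF c[OF a] c[OF b] _ eq that]
      unfolding cat.leaves_def[OF c[OF a]] cat.leaves_def[OF c[OF b]] R_def by blast
    show "a = b"
    proof (rule PiE_ext[OF a b])
      fix m assume m: "m \<in> {2..k}"
      then have "card {h\<in>{..<M}. card {v\<in>{l..<n}. g a v = h} = m} =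
          card {h\<in>{..<M}. card {v\<in>{l..<n}. g b v = h} = m}"
        by (intro binomial_sums_inject[OF g(2)[OF a] g(2)[OF b] sums]) auto
      then show "a m = b m" using g(3)[OF a m] g(3)[OF b m] by simp
    qed
  qed
  moreover have "card ?P = B ^ (k - 1)" by (simp add: card_PiE)
  ultimately show ?thesis by simp
qed

section \<open>Choice of the parameters and asymptotics\<close>

text \<open>Here \<open>B = 2 ^ k\<^sup>2\<close>: the room required is then still \<open>2\<close>
  to a power quadratic in \<open>k\<close>, while the number of classes is at least \<open>2\<close>
  to a power cubic in \<open>k\<close>.\<close>

lemma graham_classes_ge_2_power:
  assumes k: "k > 0" and n: "2 ^ (6 * k\<^sup>2) \<le> n"
  shows "2 ^ (k\<^sup>2 * (k - 1)) \<le> card (graham_classes n)"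
proof -
  have kk: "k \<le> k\<^sup>2" using k by (simp add: power2_eq_square)
  have "k \<le> 2 ^ k" using less_exp[of k] by simp
  then have "k\<^sup>2 \<le> 2 ^ (k + k)" by (simp add: power2_eq_square power_add mult_le_mono)
  moreover have "2 * 2 ^ k + 2 \<le> (2::nat) ^ (k + 2)" using one_le_power[of "2::nat" k] by simp
  ultimately have "k\<^sup>2 * 2 ^ k\<^sup>2 * (2 * 2 ^ k + 2) \<le> 2 ^ (k + k) * 2 ^ k\<^sup>2 * 2 ^ (k + 2)"
    by (intro mult_le_mono) auto
  also have "\<dots> = 2 ^ (3 * k + k\<^sup>2 + 2)" by (simp add: power_add[symmetric] algebra_simps)
  \<comment> \<open>This uses \<open>3 * k + 2 \<le> 5 * k\<^sup>2\<close>, valid for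
    \<open>k \<ge> 1\<close>.\<close>
  also have "\<dots> \<le> 2 ^ (6 * k\<^sup>2)" using kk k by (intro power_increasing) linarith+
  finally have "(2 ^ k\<^sup>2) ^ (k - 1) \<le> card (graham_classes n)"
    using n k by (intro graham_classes_lower_bound) auto
  then show ?thesis by (simp add: power_mult)
qed

theorem mainTheorem1:
  "\<exists>c::real. c > 0 \<and>
     (\<lambda>n::nat. real (card (graham_classes n))) \<in> \<Omega>(\<lambda>n::nat. exp (c * ln (real n) powr (3 / 2)))"
proof (intro exI conjI)
  \<comment> \<open>With \<open>y\<close> the square root of \<open>log 2 n / 6\<close> and
    \<open>k\<close> its integer part, the exponent \<open>k\<^sup>2 * (k - 1)\<close> is at least
    \<open>y ^ 3 / 4\<close>. The constant is chosen so that \<open>c * ln n powr (3 / 2)\<close>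
    equals \<open>ln 2 * y ^ 3 / 4\<close>.\<close>
  define c :: real where "c = ln 2 / 4 / (6 * ln 2) powr (3 / 2)"
  show "c > 0" by (simp add: c_def)
  have "exp (c * ln (real n) powr (3 / 2)) \<le> real (card (graham_classes n))"
    if n: "2 ^ 96 \<le> n" for n :: nat
  proof -
    define z where "z = log 2 (real n) / 6"
    define y where "y = sqrt z"
    define k where "k = nat \<lfloor>y\<rfloor>"
    have n': "2 ^ 96 \<le> real n" using n by (metis of_nat_le_iff of_nat_numeral of_nat_power)
    then have n1: "real n > 1" by simp
    have "96 \<le> log 2 (real n)" using n' n1 by (subst le_log_iff) (simp_all add: powr_numeral)
    then have z: "16 \<le> z" by (simp add: z_def)
    then have y4: "4 \<le> y" unfolding y_def by (intro real_le_rsqrt) simp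
    have k: "real k \<le> y" "y < real k + 1" using y4 unfolding k_def by linarith+
    then have k0: "k > 0" using y4 by linarith
    have "(real k)\<^sup>2 \<le> y\<^sup>2" using k by (intro power_mono) auto
    also have "y\<^sup>2 = z" using z by (simp add: y_def)
    finally have "real (6 * k\<^sup>2) \<le> log 2 (real n)" by (simp add: z_def)
    then have "2 powr real (6 * k\<^sup>2) \<le> real n" using n1 by (simp add: le_log_iff)
    then have "real (2 ^ (6 * k\<^sup>2)) \<le> real n" by (simp add: powr_realpow[symmetric])
    then have "2 ^ (k\<^sup>2 * (k - 1)) \<le> card (graham_classes n)"
      by (intro graham_classes_ge_2_power[OF k0]) simp
    then have card: "2 ^ (k\<^sup>2 * (k - 1)) \<le> real (card (graham_classes n))"
      by (metis of_nat_le_iff of_nat_numeral of_nat_power)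
    \<comment> \<open>The threshold \<open>2 ^ 96\<close> gives \<open>y \<ge> 4\<close>, so that
      \<open>k > y - 1 \<ge> 3 / 4 * y\<close> and \<open>k - 1 > y - 2 \<ge> y / 2\<close>. The
      product of the lower bounds is \<open>9 / 32 * y ^ 3\<close>.\<close>
    have "(3 / 4 * y)\<^sup>2 * (1 / 2 * y) \<le> (real k)\<^sup>2 * (real k - 1)"
      using k y4 by (intro mult_mono power_mono) auto
    moreover have "1 / 4 * y ^ 3 \<le> (3 / 4 * y)\<^sup>2 * (1 / 2 * y)"
      using y4 by (simp add: power2_eq_square power3_eq_cube)
    ultimately have exp_le: "1 / 4 * y ^ 3 \<le> real (k\<^sup>2 * (k - 1))"
      using k0 by (simp add: of_nat_diff)
    have "y ^ 3 = z powr (3 / 2)"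
      using z by (simp add: y_def powr_half_sqrt[symmetric] powr_power)
    also have "z = ln (real n) / (6 * ln 2)" by (simp add: z_def log_def)
    also have "\<dots> powr (3 / 2) = ln (real n) powr (3 / 2) / (6 * ln 2) powr (3 / 2)"
      by (rule powr_divide)
    finally have "c * ln (real n) powr (3 / 2) = 1 / 4 * y ^ 3 * ln 2"
      by (simp add: c_def)
    also have "\<dots> \<le> real (k\<^sup>2 * (k - 1)) * ln 2"
      using exp_le by (intro mult_right_mono) auto
    finally have "exp (c * ln (real n) powr (3 / 2)) \<le> exp (real (k\<^sup>2 * (k - 1)) * ln 2)"
      by simp
    also have "\<dots> = 2 ^ (k\<^sup>2 * (k - 1))" by (simp only: exp_of_nat_mult exp_ln zero_less_numeral)
    also note card
    finally show ?thesis .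
  qed
  then have "eventually (\<lambda>n::nat. norm (real (card (graham_classes n))) \<ge>
      1 * norm (exp (c * ln (real n) powr (3 / 2)))) at_top"
    by (intro eventually_at_top_linorderI[of "2 ^ 96"]) simp
  then show "(\<lambda>n::nat. real (card (graham_classes n))) \<in> \<Omega>(\<lambda>n::nat. exp (c * ln (real n) powr (3 / 2)))"
    by (intro landau_omega.bigI[of 1]) auto
qed

end
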